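(* Let $n,m,k$ be integers with $m\ge 1$ and $1\le k<n$, and let $(p_{ij})\in\{0,1\}^{n\times m}$ be a matrix of voters' preference profiles. Then the mixed-integer linear program, in the variables $x\in\{0,1\}^m$, $z=(z_{ij})\in\mathbb{R}^{n\times m}$, $d=(d_i)\in\mathbb{R}^n$, $u=(u_i)\in\mathbb{R}^n$, $v=(v_h)\in\mathbb{R}^k$, $$\begin{aligned}\min\ & \sum_{i=1}^n u_i+\sum_{h=1}^k v_h\\ \text{s.t. } & u_i+v_h\ge d_i && i=1,\dots,n,\ h=1,\dots,k,\\ & d_i\ge\sum_{j=1}^m z_{ij} && i=1,\dots,n,\\ & z_{ij}\ge x_j(1-p_{ij})+p_{ij}(1-x_j) && i=1,\dots,n,\ j=1,\dots,m,\\ & x_j\in\{0,1\} && j=1,\dots,m,\\ & u_i\ge 0 && i=1,\dots,n,\\ & v_h\ge 0 && h=1,\dots,k\end{aligned}$$ is a valid formulation of the $k$-sum approval voting problem; that is, its optimal value equals the optimal value of the $k$-sum approval voting problem, and a committee $x\in\{0,1\}^m$ is optimal for the $k$-sum approval voting problem if and only if $x$ is the $x$-part of some optimal solution of the program.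
   Context: There are $n$ voters and $m$ candidates. The preference profile of voter $i$ is the vector $P_i=(p_{i1},\dots,p_{im})\in\{0,1\}^m$, with $p_{ij}=1$ if and only if voter $i$ approves candidate $j$. A committee is a vector $x\in\{0,1\}^m$ (no constraint on its size). The Hamming distance of voter $i$ to $x$ is $d_i(x)=\sum_{j=1}^m|p_{ij}-x_j|$. The $k$-sum approval voting problem is to find $x\in\{0,1\}^m$ minimizing the sum of the $k$ largest among the $n$ numbers $d_1(x),\dots,d_n(x)$ (counted with multiplicity); its optimal value is this minimum. *)

theory Defs
  imports Complex_Main "HOL-Library.FuncSet"
begin

text \<open>
  Indices run over \<open>{1..n}\<close> (voters), \<open>{1..m}\<close> (candidates) and \<open>{1..k}\<close>. A vector with index
  set \<open>I\<close> and entries in \<open>S\<close> is an element of \<open>I \<rightarrow>\<^sub>E S\<close>, so vectors are determined by their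
  entries. All 0/1 data are real numbers.
\<close>

definition committees :: "nat \<Rightarrow> (nat \<Rightarrow> real) set" where
  "committees m = {1..m} \<rightarrow>\<^sub>E {0, 1}"

definition profiles :: "nat \<Rightarrow> nat \<Rightarrow> (nat \<Rightarrow> nat \<Rightarrow> real) set" where
  "profiles n m = {1..n} \<rightarrow>\<^sub>E ({1..m} \<rightarrow>\<^sub>E {0, 1})"

definition hamming :: "nat \<Rightarrow> (nat \<Rightarrow> nat \<Rightarrow> real) \<Rightarrow> (nat \<Rightarrow> real) \<Rightarrow> nat \<Rightarrow> real" where
  "hamming m p x i = (\<Sum>j = 1..m. \<bar>p i j - x j\<bar>)"

definition sum_k_largest :: "nat \<Rightarrow> real list \<Rightarrow> real" where
  "sum_k_largest k ys = sum_list (take k (rev (sort ys)))"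

definition ksum :: "nat \<Rightarrow> nat \<Rightarrow> nat \<Rightarrow> (nat \<Rightarrow> nat \<Rightarrow> real) \<Rightarrow> (nat \<Rightarrow> real) \<Rightarrow> real" where
  "ksum n m k p x = sum_k_largest k (map (hamming m p x) [1..<Suc n])"

type_synonym milp_point =
  "(nat \<Rightarrow> real) \<times> (nat \<Rightarrow> nat \<Rightarrow> real) \<times> (nat \<Rightarrow> real) \<times> (nat \<Rightarrow> real) \<times> (nat \<Rightarrow> real)"

definition milp_feasible ::
    "nat \<Rightarrow> nat \<Rightarrow> nat \<Rightarrow> (nat \<Rightarrow> nat \<Rightarrow> real) \<Rightarrow> milp_point set" where
  "milp_feasible n m k p = {(x, z, d, u, v).
     x \<in> {1..m} \<rightarrow>\<^sub>E {0, 1} \<and>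
     z \<in> {1..n} \<rightarrow>\<^sub>E ({1..m} \<rightarrow>\<^sub>E UNIV) \<and>
     d \<in> {1..n} \<rightarrow>\<^sub>E UNIV \<and>
     u \<in> {1..n} \<rightarrow>\<^sub>E UNIV \<and>
     v \<in> {1..k} \<rightarrow>\<^sub>E UNIV \<and>
     (\<forall>i\<in>{1..n}. \<forall>h\<in>{1..k}. u i + v h \<ge> d i) \<and>
     (\<forall>i\<in>{1..n}. d i \<ge> (\<Sum>j = 1..m. z i j)) \<and>
     (\<forall>i\<in>{1..n}. \<forall>j\<in>{1..m}. z i j \<ge> x j * (1 - p i j) + p i j * (1 - x j)) \<and>
     (\<forall>i\<in>{1..n}. u i \<ge> 0) \<and>
     (\<forall>h\<in>{1..k}. v h \<ge> 0)}"

definition milp_objective :: "nat \<Rightarrow> nat \<Rightarrow> milp_point \<Rightarrow> real" where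
  "milp_objective n k = (\<lambda>(x, z, d, u, v). (\<Sum>i = 1..n. u i) + (\<Sum>h = 1..k. v h))"

text \<open>
  The optimal value is an attained minimum, stated as a relation so that an unattained or
  unbounded problem has none. Optimal solutions are expressed by \<^const>\<open>is_arg_min\<close>.
\<close>

definition optimal_value :: "('a \<Rightarrow> real) \<Rightarrow> 'a set \<Rightarrow> real \<Rightarrow> bool" where
  "optimal_value f S w \<longleftrightarrow> w \<in> f ` S \<and> (\<forall>s\<in>S. w \<le> f s)"

end

theory Submission
  imports Defs
begin

text \<open>
  For a fixed committee, the rest of the program is the dual of the assignment-type linear program
  selecting \<open>k\<close> of the \<open>n\<close> distances. A bijection between \<open>{1..k}\<close> and a set \<open>A\<close> of \<open>k\<close>
  largest distances bounds every feasible objective from below by the \<open>k\<close>-sum. With \<open>t\<close> the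
  \<open>k\<close>-th largest distance, \<open>v\<^sub>h = t\<close> and \<open>u\<^sub>i = max (d\<^sub>i - t) 0\<close> attain this bound.
\<close>

lemma map_insort_key: "map f (insort_key f x xs) = insort (f x) (map f xs)"
  by (induction xs) simp_all

text \<open>Lets the values be sorted through their arguments, so that the \<open>k\<close> largest
  values come with the elements of \<open>xs\<close> that produce them.\<close>

lemma map_sort_key: "map f (sort_key f xs) = sort (map f xs)"
  by (induction xs) (simp_all add: map_insort_key)

text \<open>Arrange \<open>xs\<close> by descending \<open>f\<close> and let \<open>A\<close> be the
  first \<open>k\<close> elements. Since \<open>xs\<close> is distinct, these are \<open>k\<close>
  different arguments even when values tie, and the list sum becomes a sum over
  \<open>A\<close>.\<close>

lemma sum_k_largest_map:
  assumes "distinct xs" "k \<le> length xs"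
  obtains A where "A \<subseteq> set xs" "card A = k" "sum_k_largest k (map f xs) = sum f A"
    "\<And>i j. i \<in> A \<Longrightarrow> j \<in> set xs - A \<Longrightarrow> f j \<le> f i"
proof -
  define ys where "ys = rev (sort_key f xs)"
  have dist: "distinct ys" and set_ys: "set ys = set xs" and len: "length ys = length xs"
    using assms(1) by (simp_all add: ys_def)
  have sort: "rev (sort (map f xs)) = map f ys"
    by (simp add: ys_def rev_map flip: map_sort_key)
  have desc: "sorted_wrt (\<lambda>i j. f j \<le> f i) ys"
    using sorted_sort_key[of f xs] by (simp add: ys_def sorted_wrt_rev sorted_wrt_map)
  show thesis
  proof (rule that[of "set (take k ys)"])
    show "set (take k ys) \<subseteq> set xs"
      using set_take_subset[of k ys] set_ys by simp
    show "card (set (take k ys)) = k"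
      using dist len assms(2) by (simp add: distinct_card)
    show "sum_k_largest k (map f xs) = sum f (set (take k ys))"
      using dist by (simp add: sum_k_largest_def sort take_map sum_list_distinct_conv_sum_set)
    fix i j
    assume i: "i \<in> set (take k ys)" and "j \<in> set xs - set (take k ys)"
    then have j: "j \<in> set (drop k ys)"
      using set_ys set_append[of "take k ys" "drop k ys"] by auto
    \<comment> \<open>Elements of \<open>A\<close> stand in the front segment and all others in the
      rear one, so the descending order compares them.\<close>
    have "sorted_wrt (\<lambda>i j. f j \<le> f i) (take k ys @ drop k ys)"
      using desc by simp
    then show "f j \<le> f i"
      using i j by (simp add: sorted_wrt_append del: append_take_drop_id)
  qed
qed

text \<open>Weak duality: adding the cover inequalities along a bijection from \<open>A\<close> to
  \<open>H\<close> uses every \<open>v h\<close> exactly once, and the \<open>u i\<close> with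
  \<open>i\<close> outside \<open>A\<close> cannot lower the right side.\<close>

lemma sum_le_cover:
  fixes f :: "'a \<Rightarrow> real"
  assumes "finite N" "A \<subseteq> N" "finite H" "card A = card H"
    and cover: "\<And>i h. i \<in> N \<Longrightarrow> h \<in> H \<Longrightarrow> f i \<le> u i + v h"
    and nonneg: "\<And>i. i \<in> N \<Longrightarrow> 0 \<le> u i"
  shows "sum f A \<le> sum u N + sum v H"
proof -
  have "finite A"
    using assms(1,2) finite_subset by blast
  then obtain \<sigma> where \<sigma>: "bij_betw \<sigma> A H"
    using assms(3,4) finite_same_card_bij by blast
  have "sum f A \<le> (\<Sum>i\<in>A. u i + v (\<sigma> i))"
    using assms(2) \<sigma> by (intro sum_mono cover) (auto dest: bij_betwE)
  also have "\<dots> = sum u A + sum v H"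
    by (simp add: sum.distrib sum.reindex_bij_betw[OF \<sigma>])
  also have "sum u A \<le> sum u N"
    using assms(1,2) nonneg by (intro sum_mono2) auto
  finally show ?thesis
    by simp
qed

text \<open>Equality in the duality bound: cutting at the least value on \<open>A\<close> leaves no
  excess outside \<open>A\<close> and needs no truncation on \<open>A\<close>, so each element of
  \<open>A\<close> contributes its excess plus \<open>t\<close>.\<close>

lemma threshold_cover:
  fixes f :: "'a \<Rightarrow> real"
  assumes "finite N" "A \<subseteq> N" "A \<noteq> {}"
    and top: "\<And>i j. i \<in> A \<Longrightarrow> j \<in> N - A \<Longrightarrow> f j \<le> f i"
    and nonneg: "\<And>i. i \<in> N \<Longrightarrow> 0 \<le> f i"
  obtains t :: real where "0 \<le> t" "(\<Sum>i\<in>N. max (f i - t) 0) + card A * t = sum f A"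
proof -
  have "finite A"
    using assms(1,2) finite_subset by blast
  define t where "t = Min (f ` A)"
  have "t \<in> f ` A"
    using \<open>finite A\<close> \<open>A \<noteq> {}\<close> by (simp add: t_def)
  then have outside: "f j \<le> t" if "j \<in> N - A" for j
    using top that by auto
  have inside: "t \<le> f i" if "i \<in> A" for i
    using \<open>finite A\<close> that by (simp add: t_def)
  have "(\<Sum>i\<in>N. max (f i - t) 0) = (\<Sum>i\<in>A. f i - t)"
    using assms(1,2) inside outside by (intro sum.mono_neutral_cong_right) auto
  then have "(\<Sum>i\<in>N. max (f i - t) 0) + card A * t = sum f A"
    by (simp add: sum_subtractf)
  moreover have "0 \<le> t"
    using \<open>t \<in> f ` A\<close> assms(2) nonneg by auto
  ultimately show thesis
    using that by blast
qed

text \<open>Turns a Hamming term into the right side of the constraint on \<open>z\<close>, which is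
  affine in the committee entry \<open>b\<close> once the profile entry \<open>a\<close> is
  fixed.\<close>

lemma abs_diff_binary:
  fixes a b :: real
  assumes "a \<in> {0, 1}" "b \<in> {0, 1}"
  shows "\<bar>a - b\<bar> = b * (1 - a) + a * (1 - b)"
  using assms by auto

lemma hamming_committee:
  assumes "p \<in> profiles n m" "x \<in> committees m" "i \<in> {1..n}"
  shows "hamming m p x i = (\<Sum>j = 1..m. x j * (1 - p i j) + p i j * (1 - x j))"
  unfolding hamming_def
proof (intro sum.cong refl abs_diff_binary)
  fix j assume j: "j \<in> {1..m}"
  show "p i j \<in> {0, 1}"
    using PiE_mem[OF PiE_mem[OF assms(1)[unfolded profiles_def] assms(3)] j] .
  show "x j \<in> {0, 1}"
    using PiE_mem[OF assms(2)[unfolded committees_def] j] .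
qed

text \<open>The constraints chain together: a Hamming distance is at most a row sum of
  \<open>z\<close>, hence at most \<open>d i\<close>, hence at most \<open>u i + v h\<close>. Thus
  \<open>sum_le_cover\<close> applies with \<open>H = {1..k}\<close>.\<close>

lemma ksum_le_milp_objective:
  assumes "k \<le> n" "p \<in> profiles n m" "(x, z, d, u, v) \<in> milp_feasible n m k p"
  shows "ksum n m k p x \<le> milp_objective n k (x, z, d, u, v)"
proof -
  let ?N = "{1..n}"
  have len: "k \<le> length [1..<Suc n]"
    using assms(1) by simp
  obtain A where A: "A \<subseteq> set [1..<Suc n]" "card A = k" "ksum n m k p x = sum (hamming m p x) A"
    using sum_k_largest_map[OF distinct_upt len, of "hamming m p x"] unfolding ksum_def by blast
  have "x \<in> committees m"
    using assms(3) by (simp add: milp_feasible_def committees_def)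
  have "hamming m p x i \<le> d i" if "i \<in> ?N" for i
  proof -
    have "hamming m p x i \<le> (\<Sum>j = 1..m. z i j)"
      unfolding hamming_committee[OF assms(2) \<open>x \<in> committees m\<close> that]
      using assms(3) that by (intro sum_mono) (auto simp: milp_feasible_def)
    also have "\<dots> \<le> d i"
      using assms(3) that by (auto simp: milp_feasible_def)
    finally show ?thesis .
  qed
  moreover have "d i \<le> u i + v h" if "i \<in> ?N" "h \<in> {1..k}" for i h
    using assms(3) that by (auto simp: milp_feasible_def)
  ultimately have "hamming m p x i \<le> u i + v h" if "i \<in> ?N" "h \<in> {1..k}" for i h
    using that by (meson order_trans)
  moreover have "0 \<le> u i" if "i \<in> ?N" for i
    using assms(3) that by (auto simp: milp_feasible_def)
  moreover have "A \<subseteq> ?N"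
    using A(1) by auto
  ultimately have "sum (hamming m p x) A \<le> sum u ?N + sum v {1..k}"
    using A(2) by (intro sum_le_cover) auto
  then show ?thesis
    using A(3) by (simp add: milp_objective_def)
qed

lemma milp_objective_attains_ksum:
  assumes "1 \<le> k" "k \<le> n" "p \<in> profiles n m" "x \<in> committees m"
  obtains z d u v where "(x, z, d, u, v) \<in> milp_feasible n m k p"
    "milp_objective n k (x, z, d, u, v) = ksum n m k p x"
proof -
  let ?N = "{1..n}" and ?f = "hamming m p x"
  have N: "set [1..<Suc n] = ?N"
    by auto
  have len: "k \<le> length [1..<Suc n]"
    using assms(2) by simp
  obtain A where A: "A \<subseteq> ?N" "card A = k" "ksum n m k p x = sum ?f A"
    and top: "\<And>i j. i \<in> A \<Longrightarrow> j \<in> ?N - A \<Longrightarrow> ?f j \<le> ?f i"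
    using sum_k_largest_map[OF distinct_upt len, of ?f] unfolding N ksum_def by blast
  \<comment> \<open>Here \<open>1 \<le> k\<close> enters: the threshold is a minimum over
    \<open>A\<close>.\<close>
  have "A \<noteq> {}"
    using A(2) assms(1) by auto
  have nonneg: "0 \<le> ?f i" for i
    by (simp add: hamming_def sum_nonneg)
  obtain t :: real where t: "0 \<le> t" "(\<Sum>i\<in>?N. max (?f i - t) 0) + card A * t = sum ?f A"
    using threshold_cover[OF finite_atLeastAtMost A(1) \<open>A \<noteq> {}\<close> top nonneg] .
  \<comment> \<open>The constraints on \<open>z\<close> and \<open>d\<close> are taken with
    equality, so that \<open>d\<close> is the vector of distances. Restriction to the index sets
    makes the vectors extensional, as feasibility demands.\<close>
  define z where
    "z = (\<lambda>i\<in>?N. \<lambda>j\<in>{1..m}. x j * (1 - p i j) + p i j * (1 - x j))"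
  define u where "u = (\<lambda>i\<in>?N. max (?f i - t) 0)"
  define v where "v = (\<lambda>h\<in>{1..k}. t)"
  have "(\<Sum>j = 1..m. z i j) = ?f i" if "i \<in> ?N" for i
    using that by (simp add: z_def hamming_committee[OF assms(3,4)])
  then have "(x, z, restrict ?f ?N, u, v) \<in> milp_feasible n m k p"
    using assms(4) t(1)
    by (auto simp: milp_feasible_def committees_def z_def u_def v_def)
  \<comment> \<open>The constant vector \<open>v\<close> sums to \<open>k * t\<close>, which is the
    term \<open>card A * t\<close> of the threshold identity.\<close>
  moreover have "milp_objective n k (x, z, restrict ?f ?N, u, v) = ksum n m k p x"
    using A(2,3) t(2) by (simp add: milp_objective_def u_def v_def)
  ultimately show thesis
    using that by blast
qed

theorem theorem4:
  fixes n m k :: nat and p :: "nat \<Rightarrow> nat \<Rightarrow> real"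
  assumes "m \<ge> 1" and "1 \<le> k" and "k < n"
    and "p \<in> profiles n m"
  shows "(\<exists>w. optimal_value (ksum n m k p) (committees m) w \<and>
              optimal_value (milp_objective n k) (milp_feasible n m k p) w) \<and>
         (\<forall>x \<in> committees m.
            is_arg_min (ksum n m k p) (\<lambda>y. y \<in> committees m) x \<longleftrightarrow>
            (\<exists>z d u v. is_arg_min (milp_objective n k)
                         (\<lambda>s. s \<in> milp_feasible n m k p) (x, z, d, u, v)))"
proof -
  let ?f = "ksum n m k p" and ?g = "milp_objective n k"
    and ?S = "committees m" and ?T = "milp_feasible n m k p"
  \<comment> \<open>Projection to the committee never increases the cost; \<open>lift\<close> below
    returns from a committee at equal cost. Both claims follow from this pair.\<close>
  have lower: "fst s \<in> ?S \<and> ?f (fst s) \<le> ?g s" if "s \<in> ?T" for s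
  proof (cases s)
    case (fields x z d u v)
    then show ?thesis
      using ksum_le_milp_objective[of k n p m x z d u v] that assms(3,4)
      by (simp add: milp_feasible_def committees_def)
  qed
  have lift: "\<exists>z d u v. (x, z, d, u, v) \<in> ?T \<and> ?g (x, z, d, u, v) = ?f x" if "x \<in> ?S" for x
    by (rule milp_objective_attains_ksum[OF assms(2) less_imp_le[OF assms(3)] assms(4) that])
      (intro exI conjI)
  \<comment> \<open>There are only finitely many committees, so the minimum is attained at some
    \<open>a\<close>.\<close>
  have "finite ?S" and "?S \<noteq> {}"
    by (simp_all add: committees_def finite_PiE PiE_eq_empty_iff)
  then obtain a where a: "a \<in> ?S" "\<And>x. x \<in> ?S \<Longrightarrow> ?f a \<le> ?f x"
    using ex_is_arg_min_if_finite[of ?S ?f] by (auto simp: is_arg_min_linorder)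
  have "optimal_value ?f ?S (?f a)"
    using a by (auto simp: optimal_value_def)
  moreover have "optimal_value ?g ?T (?f a)"
    unfolding optimal_value_def
  proof
    obtain s where "s \<in> ?T" "?g s = ?f a"
      using lift[OF a(1)] by blast
    then show "?f a \<in> ?g ` ?T"
      by (metis imageI)
    show "\<forall>s\<in>?T. ?f a \<le> ?g s"
      using lower a(2) order_trans by blast
  qed
  moreover have "is_arg_min ?f (\<lambda>y. y \<in> ?S) x \<longleftrightarrow>
      (\<exists>z d u v. is_arg_min ?g (\<lambda>s. s \<in> ?T) (x, z, d, u, v))" if x: "x \<in> ?S" for x
  proof
    assume opt: "is_arg_min ?f (\<lambda>y. y \<in> ?S) x"
    obtain z d u v where s: "(x, z, d, u, v) \<in> ?T" "?g (x, z, d, u, v) = ?f x"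
      using lift[OF x] by blast
    have opt': "?f x \<le> ?f y" if "y \<in> ?S" for y
      using opt that by (simp add: is_arg_min_linorder)
    \<comment> \<open>A competitor costs at least as much as its own committee, hence at least as
      much as \<open>x\<close>, whose lift attains that bound.\<close>
    have "?f x \<le> ?g s'" if "s' \<in> ?T" for s'
      using lower[OF that] opt'[of "fst s'"] by linarith
    then have "is_arg_min ?g (\<lambda>s. s \<in> ?T) (x, z, d, u, v)"
      using s unfolding is_arg_min_linorder by simp
    then show "\<exists>z d u v. is_arg_min ?g (\<lambda>s. s \<in> ?T) (x, z, d, u, v)"
      by (intro exI)
  next
    assume "\<exists>z d u v. is_arg_min ?g (\<lambda>s. s \<in> ?T) (x, z, d, u, v)"
    then obtain z d u v where "is_arg_min ?g (\<lambda>s. s \<in> ?T) (x, z, d, u, v)"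
      by (elim exE)
    then have s: "(x, z, d, u, v) \<in> ?T"
      and opt: "\<And>s'. s' \<in> ?T \<Longrightarrow> ?g (x, z, d, u, v) \<le> ?g s'"
      unfolding is_arg_min_linorder by (simp_all del: split_paired_All)
    have "?f x \<le> ?f y" if "y \<in> ?S" for y
    proof -
      \<comment> \<open>Comparing with a lift \<open>s'\<close> of \<open>y\<close> gives
        \<open>?f x \<le> ?g (x, z, d, u, v) \<le> ?g s' = ?f y\<close>.\<close>
      obtain s' where "s' \<in> ?T" "?g s' = ?f y"
        using lift[OF \<open>y \<in> ?S\<close>] by blast
      then show ?thesis
        using lower[OF s] opt[of s'] unfolding fst_conv by linarith
    qed
    then show "is_arg_min ?f (\<lambda>y. y \<in> ?S) x"
      using x by (simp add: is_arg_min_linorder)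
  qed
  ultimately show ?thesis
    by (intro conjI exI[of _ "?f a"] ballI)
qed

end
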